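(* Let $\alpha$ be an ordinal and $U$ a nonempty set. In the full function substitution algebra of dimension $\alpha$ with base $U$, elements are strongly distinguished.
   Context: $F_\alpha(U)$ is the set of all functions $U^\alpha\to U$. For $s\in U^\alpha$, $\kappa<\alpha$, $x\in U$, $s\langle\kappa,x\rangle$ agrees with $s$ except that its $\kappa$-th entry is $x$. On $F_\alpha(U)$ set $(f*_\kappa g)(s)=g(s\langle\kappa,f(s)\rangle)$ and $V_\kappa(s)=s_\kappa$; the full function substitution algebra with base $U$ is $\langle F_\alpha(U),*_\kappa,V_\kappa\rangle_{\kappa<\alpha}$. For an algebra $\langle A,*_\kappa,v_\kappa\rangle_{\kappa<\alpha}$ and $x\in A$, $\Delta x=\{\kappa<\alpha: a*_\kappa x\neq x\text{ for some }a\in A\}$, and $Z=\{x\in A:\Delta x=\emptyset\}$. For $s\in A^\alpha$, $a\in A$, finite $\Sigma=\{\kappa_0<\dots<\kappa_{n-1}\}\subseteq\alpha$: $s*_{(\Sigma)}a=s_{\kappa_{n-1}}*_{\kappa_{n-1}}(\cdots(s_{\kappa_0}*_{\kappa_0}a)\cdots)$, with $s*_{(\emptyset)}a=a$. Elements are strongly distinguished in the algebra if for all $a,b\in A$: whenever for every $s\in Z^\alpha$ there is a finite $\Sigma\subseteq\alpha$ with $s*_{(\Sigma)}a=s*_{(\Sigma)}b$, then $a=b$. *)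

theory Defs
  imports Main "HOL-Library.FuncSet"
begin

text \<open>
  An ordinal is given by a well-order \<open>\<alpha>\<close> of that type, in the sense of the library predicate
  \<^const>\<open>Well_order\<close>; its elements \<open>\<kappa> < \<alpha>\<close> are the members of \<^term>\<open>Field \<alpha>\<close>. The ordinal \<open>0\<close>
  is the empty relation. The power \<open>X\<^sup>\<alpha>\<close> is the set of extensional functions
  \<^term>\<open>Field \<alpha> \<rightarrow>\<^sub>E X\<close>.
\<close>

record ('k, 'a) subst_alg =
  elems :: "'a set"
  subst :: "'k \<Rightarrow> 'a \<Rightarrow> 'a \<Rightarrow> 'a"
  vrb :: "'k \<Rightarrow> 'a"

definition dim_set :: "'k rel \<Rightarrow> ('k, 'a) subst_alg \<Rightarrow> 'a \<Rightarrow> 'k set" where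
  "dim_set \<alpha> \<AA> x = {\<kappa> \<in> Field \<alpha>. \<exists>a \<in> elems \<AA>. subst \<AA> \<kappa> a x \<noteq> x}"

definition zero_dim :: "'k rel \<Rightarrow> ('k, 'a) subst_alg \<Rightarrow> 'a set" where
  "zero_dim \<alpha> \<AA> = {x \<in> elems \<AA>. dim_set \<alpha> \<AA> x = {}}"

definition increasing_list :: "'k rel \<Rightarrow> 'k set \<Rightarrow> 'k list" where
  "increasing_list \<alpha> \<Sigma> =
     (THE ks. set ks = \<Sigma> \<and> sorted_wrt (\<lambda>\<kappa> \<mu>. (\<kappa>, \<mu>) \<in> \<alpha> - Id) ks)"

text \<open>
  \<^const>\<open>fold\<close> runs through the list from the left, so the substitution at the least index
  of \<open>\<Sigma>\<close> is the innermost one.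
\<close>

definition subst_along ::
    "'k rel \<Rightarrow> ('k, 'a) subst_alg \<Rightarrow> ('k \<Rightarrow> 'a) \<Rightarrow> 'k set \<Rightarrow> 'a \<Rightarrow> 'a" where
  "subst_along \<alpha> \<AA> s \<Sigma> a = fold (\<lambda>\<kappa> x. subst \<AA> \<kappa> (s \<kappa>) x) (increasing_list \<alpha> \<Sigma>) a"

definition strongly_distinguished :: "'k rel \<Rightarrow> ('k, 'a) subst_alg \<Rightarrow> bool" where
  "strongly_distinguished \<alpha> \<AA> \<longleftrightarrow>
     (\<forall>a \<in> elems \<AA>. \<forall>b \<in> elems \<AA>.
        (\<forall>s \<in> Field \<alpha> \<rightarrow>\<^sub>E zero_dim \<alpha> \<AA>.
           \<exists>\<Sigma>. finite \<Sigma> \<and> \<Sigma> \<subseteq> Field \<alpha> \<and>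
             subst_along \<alpha> \<AA> s \<Sigma> a = subst_along \<alpha> \<AA> s \<Sigma> b) \<longrightarrow> a = b)"

definition full_fsa :: "'k rel \<Rightarrow> 'u set \<Rightarrow> ('k, ('k \<Rightarrow> 'u) \<Rightarrow> 'u) subst_alg" where
  "full_fsa \<alpha> U =
     \<lparr> elems = (Field \<alpha> \<rightarrow>\<^sub>E U) \<rightarrow>\<^sub>E U,
       subst = (\<lambda>\<kappa> f g. \<lambda>s \<in> Field \<alpha> \<rightarrow>\<^sub>E U. g (s(\<kappa> := f s))),
       vrb = (\<lambda>\<kappa>. \<lambda>s \<in> Field \<alpha> \<rightarrow>\<^sub>E U. s \<kappa>) \<rparr>"

lemma vrb_full_fsa_closed:
  "\<kappa> \<in> Field \<alpha> \<Longrightarrow> vrb (full_fsa \<alpha> U) \<kappa> \<in> elems (full_fsa \<alpha> U)"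
  by (auto simp: full_fsa_def)

lemma subst_full_fsa_closed:
  assumes "\<kappa> \<in> Field \<alpha>" "f \<in> elems (full_fsa \<alpha> U)" "g \<in> elems (full_fsa \<alpha> U)"
  shows "subst (full_fsa \<alpha> U) \<kappa> f g \<in> elems (full_fsa \<alpha> U)"
proof -
  have "g (s(\<kappa> := f s)) \<in> U" if s: "s \<in> Field \<alpha> \<rightarrow>\<^sub>E U" for s
  proof -
    have "f s \<in> U" using assms(2) s by (auto simp: full_fsa_def)
    hence "s(\<kappa> := f s) \<in> Field \<alpha> \<rightarrow>\<^sub>E U"
      using s assms(1) by (auto simp: PiE_iff extensional_def)
    thus ?thesis using assms(3) by (auto simp: full_fsa_def)
  qed
  thus ?thesis by (simp add: full_fsa_def)
qed

text \<open>The description in \<^const>\<open>increasing_list\<close> is proper for every finite set of indices.\<close>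

lemma increasing_list_ex1:
  assumes "Well_order \<alpha>" "finite \<Sigma>" "\<Sigma> \<subseteq> Field \<alpha>"
  shows "\<exists>!ks. set ks = \<Sigma> \<and> sorted_wrt (\<lambda>\<kappa> \<mu>. (\<kappa>, \<mu>) \<in> \<alpha> - Id) ks"
proof -
  let ?P = "\<lambda>\<kappa> \<mu>. (\<kappa>, \<mu>) \<in> \<alpha> - Id"
  have lin: "trans \<alpha>" "antisym \<alpha>" "total_on (Field \<alpha>) \<alpha>"
    using assms(1) by (auto simp: order_on_defs)
  have wf: "wf (\<alpha> - Id)" using assms(1) by (simp add: well_order_on_def)
  have ex: "\<exists>ks. set ks = \<Sigma> \<and> sorted_wrt ?P ks"
    using assms(2,3)
  proof (induction "card \<Sigma>" arbitrary: \<Sigma>)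
    case 0
    thus ?case by (auto intro: exI[of _ "[]"])
  next
    case (Suc n)
    then obtain m where m: "m \<in> \<Sigma>" "\<And>y. (y, m) \<in> \<alpha> - Id \<Longrightarrow> y \<notin> \<Sigma>"
      using wfE_min'[OF wf, of \<Sigma>] by (metis card.empty nat.distinct(1))
    obtain ks where ks: "set ks = \<Sigma> - {m}" "sorted_wrt ?P ks"
    proof -
      have "n = card (\<Sigma> - {m})" using Suc.hyps(2) Suc.prems m(1) by simp
      moreover have "finite (\<Sigma> - {m})" "\<Sigma> - {m} \<subseteq> Field \<alpha>" using Suc.prems by auto
      ultimately show thesis using Suc.hyps(1) that by blast
    qed
    have "(m, y) \<in> \<alpha> - Id" if "y \<in> \<Sigma> - {m}" for y
      using that m Suc.prems(2) lin(3) unfolding total_on_def by blast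
    hence "set (m # ks) = \<Sigma> \<and> sorted_wrt ?P (m # ks)" using ks m(1) by auto
    thus ?case by blast
  qed
  have uniq: "xs = ys" if "sorted_wrt ?P xs" "sorted_wrt ?P ys" "set xs = set ys" for xs ys
    using that
  proof (induction xs arbitrary: ys)
    case Nil
    thus ?case by simp
  next
    case (Cons x xs)
    then obtain y ys' where ys: "ys = y # ys'" by (cases ys) auto
    have "x = y"
    proof (rule ccontr)
      assume "x \<noteq> y"
      hence "x \<in> set ys'" "y \<in> set xs" using Cons.prems(3) ys by auto
      hence "(y, x) \<in> \<alpha>" "(x, y) \<in> \<alpha>" using Cons.prems ys by auto
      thus False using \<open>x \<noteq> y\<close> lin(2) by (auto dest: antisymD)
    qed
    moreover have "x \<notin> set xs" "y \<notin> set ys'" using Cons.prems ys by auto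
    ultimately have "set xs = set ys'" using Cons.prems(3) ys by auto
    thus ?case using Cons ys \<open>x = y\<close> by simp
  qed
  show ?thesis using ex uniq by (metis (no_types, lifting))
qed

end

theory Submission
  imports Defs
begin

text \<open>
  Constant functions are zero-dimensional. Given a point \<open>t\<close>, let every \<open>s \<kappa>\<close> be the constant
  function with value \<open>t \<kappa>\<close>: each substitution then replaces a coordinate of \<open>t\<close> by itself, so
  \<open>s *\<^bsub>(\<Sigma>)\<^esub> a\<close> and \<open>a\<close> agree at \<open>t\<close> for every finite \<open>\<Sigma>\<close>.
\<close>

lemma const_in_zero_dim_full_fsa:
  assumes "c \<in> U"
  shows "(\<lambda>_ \<in> Field \<alpha> \<rightarrow>\<^sub>E U. c) \<in> zero_dim \<alpha> (full_fsa \<alpha> U)"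
proof -
  \<comment> \<open>A constant ignores the update, but the updated point has to stay in the domain:
    outside it the restricted function has value \<open>undefined\<close> instead of
    \<open>c\<close>.\<close>
  have "s(\<kappa> := f s) \<in> Field \<alpha> \<rightarrow>\<^sub>E U"
    if "\<kappa> \<in> Field \<alpha>" "f \<in> (Field \<alpha> \<rightarrow>\<^sub>E U) \<rightarrow>\<^sub>E U" "s \<in> Field \<alpha> \<rightarrow>\<^sub>E U" for \<kappa> f s
    using PiE_fun_upd[of "f s" "\<lambda>_. U" \<kappa> s "Field \<alpha>"] PiE_mem[OF that(2,3)] that(1,3)
    by (simp add: insert_absorb)
  hence "subst (full_fsa \<alpha> U) \<kappa> f (\<lambda>_ \<in> Field \<alpha> \<rightarrow>\<^sub>E U. c) = (\<lambda>_ \<in> Field \<alpha> \<rightarrow>\<^sub>E U. c)"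
    if "\<kappa> \<in> Field \<alpha>" "f \<in> elems (full_fsa \<alpha> U)" for \<kappa> f
    using that by (simp add: full_fsa_def cong: restrict_cong)
  moreover have "(\<lambda>_ \<in> Field \<alpha> \<rightarrow>\<^sub>E U. c) \<in> elems (full_fsa \<alpha> U)"
    using assms by (simp add: full_fsa_def)
  ultimately show ?thesis
    by (simp add: zero_dim_def dim_set_def)
qed

text \<open>Evaluated at \<open>t\<close>, a single substitution gives
  \<open>a (t(\<kappa> := s \<kappa> t))\<close>, and this update is trivial. The induction keeps
  \<open>a\<close> arbitrary because \<open>fold\<close> passes the substituted function on to the
  rest of the list.\<close>

lemma fold_subst_full_fsa_fixed_point:
  assumes "t \<in> Field \<alpha> \<rightarrow>\<^sub>E U" and "\<And>\<kappa>. \<kappa> \<in> set ks \<Longrightarrow> s \<kappa> t = t \<kappa>"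
  shows "fold (\<lambda>\<kappa>. subst (full_fsa \<alpha> U) \<kappa> (s \<kappa>)) ks a t = a t"
  using assms(2) by (induction ks arbitrary: a) (simp_all add: full_fsa_def assms(1))

theorem theorem3p3:
  fixes \<alpha> :: "'k rel" and U :: "'u set"
  assumes "Well_order \<alpha>" and "U \<noteq> {}"
  shows "strongly_distinguished \<alpha> (full_fsa \<alpha> U)"
  unfolding strongly_distinguished_def
proof (intro ballI impI)
  let ?\<AA> = "full_fsa \<alpha> U"
  fix a b
  assume a: "a \<in> elems ?\<AA>" and b: "b \<in> elems ?\<AA>"
    and agree: "\<forall>s \<in> Field \<alpha> \<rightarrow>\<^sub>E zero_dim \<alpha> ?\<AA>. \<exists>\<Sigma>. finite \<Sigma> \<and> \<Sigma> \<subseteq> Field \<alpha> \<and>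
      subst_along \<alpha> ?\<AA> s \<Sigma> a = subst_along \<alpha> ?\<AA> s \<Sigma> b"
  have "a t = b t" if t: "t \<in> Field \<alpha> \<rightarrow>\<^sub>E U" for t
  proof -
    define s where "s = (\<lambda>\<kappa> \<in> Field \<alpha>. \<lambda>_ \<in> Field \<alpha> \<rightarrow>\<^sub>E U. t \<kappa>)"
    have "s \<in> Field \<alpha> \<rightarrow>\<^sub>E zero_dim \<alpha> ?\<AA>"
      unfolding s_def using t by (intro restrict_PiE_iff[THEN iffD2] ballI
        const_in_zero_dim_full_fsa) auto
    \<comment> \<open>\<open>\<Sigma>\<close> may depend on \<open>t\<close>; this is harmless, as
      only the values at \<open>t\<close> are compared.\<close>
    then obtain \<Sigma> where \<Sigma>: "finite \<Sigma>" "\<Sigma> \<subseteq> Field \<alpha>"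
      and eq: "subst_along \<alpha> ?\<AA> s \<Sigma> a = subst_along \<alpha> ?\<AA> s \<Sigma> b"
      using agree by blast
    \<comment> \<open>The well-order makes the description in \<open>increasing_list\<close> proper.
      All listed indices then lie in \<open>Field \<alpha>\<close>, where \<open>s\<close> takes the
      chosen constants and not the default value.\<close>
    have "set (increasing_list \<alpha> \<Sigma>) = \<Sigma>"
      using theI'[OF increasing_list_ex1[OF assms(1) \<Sigma>]] by (simp add: increasing_list_def)
    hence "s \<kappa> t = t \<kappa>" if "\<kappa> \<in> set (increasing_list \<alpha> \<Sigma>)" for \<kappa>
      using that \<Sigma>(2) t by (auto simp: s_def)
    hence "subst_along \<alpha> ?\<AA> s \<Sigma> x t = x t" for x
      unfolding subst_along_def by (rule fold_subst_full_fsa_fixed_point[OF t])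
    thus ?thesis using eq by metis
  qed
  \<comment> \<open>Both functions are extensional, so agreement on the domain gives
    equality.\<close>
  thus "a = b"
    using a b by (intro PiE_ext[of a _ "\<lambda>_. U" b]) (simp_all add: full_fsa_def)
qed

end
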